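(* Let $r\ge 1$ and let $\tilde\alpha$ be the highest root of $\mathfrak{sl}_{r+1}=\mathfrak{sl}_{r+1}(\mathbb C)$. Then $$m_q(\tilde\alpha,0)=q+q^2+\cdots+q^r .$$
   Context: Setting: let $n=r+1$, $\mathfrak g=\mathfrak{sl}_n(\mathbb C)$, with Cartan subalgebra $\mathfrak h$ of diagonal trace-zero matrices and Borel subalgebra of upper triangular trace-zero matrices. For $1\le i\le n$ let $\varepsilon_i\in\mathfrak h^*$ send a diagonal matrix to its $i$-th entry (so $\varepsilon_1+\cdots+\varepsilon_n=0$ on $\mathfrak h$). The Weyl group is $W=S_n$, acting on $\mathfrak h^*$ by $\sigma(\varepsilon_i)=\varepsilon_{\sigma(i)}$. The positive roots are $\Phi^+=\{\varepsilon_i-\varepsilon_j: 1\le i<j\le n\}$, the highest root is $\tilde\alpha=\varepsilon_1-\varepsilon_n$, and $\rho=\frac12\sum_{\alpha\in\Phi^+}\alpha$. For $\sigma\in W$, $\ell(\sigma)$ is the length of $\sigma$ with respect to the neighboring transpositions $(i\;\;i+1)$, and $\epsilon(\sigma)=(-1)^{\ell(\sigma)}$. $q$-analog of Kostant's partition function: for $\xi\in\mathfrak h^*$, $\wp_q(\xi)=\sum_{j\ge 0}c_jq^j$, where $c_j$ is the number of ways to write $\xi$ as a non-negative integral sum of exactly $j$ positive roots (i.e. the number of functions $m:\Phi^+\to\{0,1,2,\dots\}$ with $\sum_{\beta}m(\beta)\beta=\xi$ and $\sum_\beta m(\beta)=j$). $q$-analog of Kostant's weight multiplicity formula: for dominant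 integral weights $\lambda,\mu$, $m_q(\lambda,\mu)=\sum_{\sigma\in W}\epsilon(\sigma)\,\wp_q(\sigma(\lambda+\rho)-(\mu+\rho))$, a polynomial in the indeterminate $q$. *)

theory Defs
  imports
    "Jordan_Normal_Form.Matrix"
    "HOL-Library.Function_Algebras"
    "HOL-Combinatorics.Permutations"
    "HOL-Computational_Algebra.Polynomial"
begin

text \<open>
  Matrix entries are indexed from 0, so \<open>eps n i\<close> (\<open>i < n\<close>) is the functional written
  $\varepsilon_{i+1}$ when rows are numbered from 1, and $S_n$ permutes \<open>{..<n}\<close>.
\<close>

definition cartan :: "nat \<Rightarrow> complex mat set" where
  "cartan n = {H \<in> carrier_mat n n. diagonal_mat H \<and> (\<Sum>i<n. H $$ (i, i)) = 0}"

text \<open>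
  Linear functionals on the Cartan subalgebra are represented by functions on all matrices that
  vanish outside \<open>cartan n\<close>. Hence equality of functions is equality of functionals on the
  Cartan subalgebra (so the sum of all \<open>eps n i\<close> is 0), and the pointwise
  \<open>+\<close>, \<open>-\<close>, \<open>0\<close> and \<open>sum\<close> of \<^theory>\<open>HOL-Library.Function_Algebras\<close> are
  those of the dual space.
\<close>

type_synonym weight = "complex mat \<Rightarrow> complex"

definition eps :: "nat \<Rightarrow> nat \<Rightarrow> weight" where
  "eps n i = (\<lambda>H. if H \<in> cartan n then H $$ (i, i) else 0)"

definition scale_weight :: "complex \<Rightarrow> weight \<Rightarrow> weight" where
  "scale_weight c \<xi> = (\<lambda>H. c * \<xi> H)"

definition pos_roots :: "nat \<Rightarrow> weight set" where
  "pos_roots n = {eps n i - eps n j | i j. i < j \<and> j < n}"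

definition highest_root :: "nat \<Rightarrow> weight" where
  "highest_root n = eps n 0 - eps n (n - 1)"

definition rho :: "nat \<Rightarrow> weight" where
  "rho n = scale_weight (1 / 2) (\<Sum>\<alpha>\<in>pos_roots n. \<alpha>)"

definition weyl_group :: "nat \<Rightarrow> (nat \<Rightarrow> nat) set" where
  "weyl_group n = {\<sigma>. \<sigma> permutes {..<n}}"

text \<open>
  The action on functionals is dual to the action of $S_n$ on diagonal matrices by permuting
  entries: $(\sigma\xi)(H) = \xi(\sigma^{-1}H)$, where $\sigma^{-1}H$ has $i$-th diagonal entry
  $H_{\sigma(i)\sigma(i)}$. Lemma \<open>weyl_act_eps\<close> below shows that this is
  the linear action with $\sigma(\varepsilon_i) = \varepsilon_{\sigma(i)}$.
\<close>

definition weyl_act :: "nat \<Rightarrow> (nat \<Rightarrow> nat) \<Rightarrow> weight \<Rightarrow> weight" where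
  "weyl_act n \<sigma> \<xi> =
     (\<lambda>H. if H \<in> cartan n then \<xi> (mat n n (\<lambda>(i, j). H $$ (\<sigma> i, \<sigma> j))) else 0)"

definition simple_reflections :: "nat \<Rightarrow> (nat \<Rightarrow> nat) set" where
  "simple_reflections n = {transpose i (Suc i) | i. Suc i < n}"

definition weyl_length :: "nat \<Rightarrow> (nat \<Rightarrow> nat) \<Rightarrow> nat" where
  "weyl_length n \<sigma> =
     (LEAST k. \<exists>ws. length ws = k \<and> set ws \<subseteq> simple_reflections n \<and> foldr (\<circ>) ws id = \<sigma>)"

definition weyl_sign :: "nat \<Rightarrow> (nat \<Rightarrow> nat) \<Rightarrow> int" where
  "weyl_sign n \<sigma> = (- 1) ^ weyl_length n \<sigma>"

text \<open>Multiplicity functions are extensional (\<open>undefined\<close> off the positive roots), so that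
  each function on the positive roots is counted once.\<close>

definition kostant_partitions :: "nat \<Rightarrow> weight \<Rightarrow> nat \<Rightarrow> (weight \<Rightarrow> nat) set" where
  "kostant_partitions n \<xi> j =
     {m \<in> pos_roots n \<rightarrow>\<^sub>E UNIV.
        (\<Sum>\<beta>\<in>pos_roots n. scale_weight (of_nat (m \<beta>)) \<beta>) = \<xi> \<and> (\<Sum>\<beta>\<in>pos_roots n. m \<beta>) = j}"

text \<open>The set counted by each coefficient is finite and almost all coefficients vanish; see
  \<open>finite_kostant_partitions\<close> and \<open>coeff_kostant_q\<close> below.\<close>

definition kostant_q :: "nat \<Rightarrow> weight \<Rightarrow> int poly" where
  "kostant_q n \<xi> = Abs_poly (\<lambda>j. int (card (kostant_partitions n \<xi> j)))"

definition mult_q :: "nat \<Rightarrow> weight \<Rightarrow> weight \<Rightarrow> int poly" where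
  "mult_q n \<Lambda> \<mu> =
     (\<Sum>\<sigma>\<in>weyl_group n.
        smult (weyl_sign n \<sigma>) (kostant_q n (weyl_act n \<sigma> (\<Lambda> + rho n) - (\<mu> + rho n))))"


lemma sum_weight_apply: "(\<Sum>x\<in>A. f x) H = (\<Sum>x\<in>A. (f x :: weight) H)"
  by (induction A rule: infinite_finite_induct) auto

lemma weyl_permuted_in_cartan:
  assumes "\<sigma> permutes {..<n}" and H: "H \<in> cartan n"
  shows "mat n n (\<lambda>(i, j). H $$ (\<sigma> i, \<sigma> j)) \<in> cartan n"
proof -
  have lt: "\<sigma> i < n" if "i < n" for i
    using permutes_in_image[OF assms(1), of i] that by simp
  have inj: "\<sigma> i = \<sigma> j \<longleftrightarrow> i = j" for i j
    using permutes_inj[OF assms(1)] by (auto dest: injD)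
  have "(\<Sum>i<n. H $$ (\<sigma> i, \<sigma> i)) = (\<Sum>i<n. H $$ (i, i))"
    using sum.permute[OF assms(1), of "\<lambda>i. H $$ (i, i)"] by (simp add: o_def)
  then show ?thesis
    using H lt inj unfolding cartan_def diagonal_mat_def by auto
qed

lemma weyl_act_eps:
  assumes "\<sigma> permutes {..<n}" and "i < n"
  shows "weyl_act n \<sigma> (eps n i) = eps n (\<sigma> i)"
  using weyl_permuted_in_cartan[OF assms(1)] assms(2)
  by (auto simp: weyl_act_def eps_def fun_eq_iff)

lemma weyl_act_add: "weyl_act n \<sigma> (\<xi> + \<eta>) = weyl_act n \<sigma> \<xi> + weyl_act n \<sigma> \<eta>"
  by (auto simp: weyl_act_def fun_eq_iff)

lemma weyl_act_scale: "weyl_act n \<sigma> (scale_weight c \<xi>) = scale_weight c (weyl_act n \<sigma> \<xi>)"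
  by (auto simp: weyl_act_def scale_weight_def fun_eq_iff)

lemma finite_pos_roots: "finite (pos_roots n)"
proof -
  have "pos_roots n \<subseteq> (\<lambda>(i, j). eps n i - eps n j) ` ({..<n} \<times> {..<n})"
    unfolding pos_roots_def by auto
  then show ?thesis by (rule finite_subset) auto
qed

lemma finite_kostant_partitions: "finite (kostant_partitions n \<xi> j)"
proof -
  have "kostant_partitions n \<xi> j \<subseteq> pos_roots n \<rightarrow>\<^sub>E {..j}"
  proof
    fix m assume m: "m \<in> kostant_partitions n \<xi> j"
    then have "m \<beta> \<le> j" if "\<beta> \<in> pos_roots n" for \<beta>
      using member_le_sum[of \<beta> "pos_roots n" m] finite_pos_roots that
      by (auto simp: kostant_partitions_def)
    then show "m \<in> pos_roots n \<rightarrow>\<^sub>E {..j}"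
      using m by (auto simp: kostant_partitions_def PiE_iff)
  qed
  then show ?thesis
    by (rule finite_subset) (auto intro: finite_PiE finite_pos_roots)
qed

lemma kostant_partitions_bounded: "\<exists>K. \<forall>j>K. kostant_partitions n \<xi> j = {}"
proof -
  define c :: "nat \<Rightarrow> complex" where "c i = (of_nat n - 1) / 2 - of_nat i" for i
  define H where "H = mat n n (\<lambda>(i, j). if i = j then c i else 0)"
  have tr: "(\<Sum>i<k. of_nat i :: complex) = of_nat k * (of_nat k - 1) / 2" for k
    by (induction k) (auto simp: field_simps)
  have "(\<Sum>i<n. c i) = 0"
    unfolding c_def by (simp add: sum_subtractf tr)
  then have H: "H \<in> cartan n"
    by (auto simp: H_def cartan_def diagonal_mat_def)
  have "\<exists>k::nat. k \<ge> 1 \<and> \<beta> H = of_nat k" if \<beta>: "\<beta> \<in> pos_roots n" for \<beta>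
  proof -
    from \<beta> obtain i j where "i < j" "j < n" "\<beta> = eps n i - eps n j"
      by (auto simp: pos_roots_def)
    then have "j - i \<ge> 1 \<and> \<beta> H = of_nat (j - i)"
      using H by (auto simp: eps_def H_def c_def of_nat_diff)
    then show ?thesis by blast
  qed
  then obtain k :: "weight \<Rightarrow> nat"
    where k: "\<And>\<beta>. \<beta> \<in> pos_roots n \<Longrightarrow> k \<beta> \<ge> 1 \<and> \<beta> H = of_nat (k \<beta>)"
    by metis
  have key: "\<exists>N. \<xi> H = of_nat N \<and> j \<le> N" if m: "m \<in> kostant_partitions n \<xi> j" for m j
  proof -
    have "\<xi> H = (\<Sum>\<beta>\<in>pos_roots n. scale_weight (of_nat (m \<beta>)) \<beta>) H"
      using m by (simp add: kostant_partitions_def)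
    also have "\<dots> = (\<Sum>\<beta>\<in>pos_roots n. of_nat (m \<beta> * k \<beta>))"
      unfolding sum_weight_apply scale_weight_def using k by (intro sum.cong) auto
    finally have "\<xi> H = of_nat (\<Sum>\<beta>\<in>pos_roots n. m \<beta> * k \<beta>)" by simp
    moreover have "j \<le> (\<Sum>\<beta>\<in>pos_roots n. m \<beta> * k \<beta>)"
    proof -
      have "j = (\<Sum>\<beta>\<in>pos_roots n. m \<beta>)" using m by (simp add: kostant_partitions_def)
      also have "\<dots> \<le> (\<Sum>\<beta>\<in>pos_roots n. m \<beta> * k \<beta>)"
        using k by (intro sum_mono) auto
      finally show ?thesis .
    qed
    ultimately show ?thesis by blast
  qed
  show ?thesis
  proof (cases "\<exists>N. \<xi> H = of_nat N")
    case True
    then obtain N where N: "\<xi> H = of_nat N" by blast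
    have "kostant_partitions n \<xi> j = {}" if "j > N" for j
      using key[of _ j] N that by fastforce
    then show ?thesis by blast
  next
    case False
    then show ?thesis using key by blast
  qed
qed

lemma coeff_kostant_q: "coeff (kostant_q n \<xi>) j = int (card (kostant_partitions n \<xi> j))"
proof -
  obtain K where "\<forall>j>K. kostant_partitions n \<xi> j = {}"
    using kostant_partitions_bounded by blast
  then have "\<forall>j>K. int (card (kostant_partitions n \<xi> j)) = 0" by simp
  then show ?thesis
    unfolding kostant_q_def by (subst coeff_Abs_poly) auto
qed

end

theory Submission
  imports Defs
begin

text \<open>
  Let \<open>n = r + 1\<close>, number the simple roots \<open>\<alpha>\<^sub>k = eps n k - eps n (k + 1)\<close> by
  \<open>k < r\<close>, and write \<open>\<xi>\<^sub>\<sigma>\<close> for the weight \<open>\<sigma>(highest root + rho) - rho\<close> whose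
  partitions are counted in the summand of \<open>\<sigma>\<close>.
  
  A weight with a Kostant partition has non-negative simple-root coordinates. For \<open>\<xi>\<^sub>\<sigma>\<close> these
  coordinates bound how far \<open>\<sigma>\<close> can move initial segments, and the bound leaves only the
  permutations that swap \<open>i\<close> and \<open>i + 1\<close> for every \<open>i\<close> in a set \<open>I\<close> without two consecutive
  elements and without the end nodes \<open>0\<close> and \<open>r - 1\<close> (\<open>kostant_partition_imp_adj_swaps\<close>). Such a
  \<open>\<sigma>\<close> has sign \<open>(-1)^|I|\<close>, and \<open>\<xi>\<^sub>\<sigma>\<close> is the sum of the \<open>\<alpha>\<^sub>k\<close> with \<open>k\<close> in the
  complement \<open>J\<close> of \<open>I\<close> (\<open>kostant_weight_adj_swaps\<close>).
  
  A positive root is an interval of simple roots, so a Kostant partition of the sum over \<open>J\<close> is a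
  tiling of \<open>J\<close> by intervals. A tiling is determined by its set \<open>S\<close> of left endpoints, which may be
  any subset of \<open>J\<close> containing the first element of every run of \<open>J\<close>, and it has \<open>|S|\<close> parts
  (\<open>kostant_q_simple_sum\<close>). The first elements of the runs are \<open>0\<close> and the \<open>i + 1\<close> with \<open>i\<close> in
  \<open>I\<close>. Hence the multiplicity is the sum of \<open>(-1)^|I| q^|S|\<close> over all pairs \<open>(I, S)\<close> such that
  \<open>S\<close> contains \<open>0\<close>, is disjoint from \<open>I\<close> and contains \<open>i + 1\<close> for every \<open>i\<close> in \<open>I\<close>.
  
  For fixed \<open>S\<close> the admissible \<open>I\<close> are all the subsets of
  \<open>D(S) = {i. i \<notin> S \<and> i + 1 \<in> S}\<close>; the conditions on \<open>I\<close> alone hold automatically. The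
  signs cancel unless \<open>D(S)\<close> is empty, and then \<open>S\<close> is an initial interval \<open>{..<k}\<close> with
  \<open>1 \<le> k \<le> r\<close>, which contributes \<open>q^k\<close>.
\<close>

section \<open>Simple-root coordinates\<close>

definition pos_root :: "nat \<Rightarrow> nat \<Rightarrow> nat \<Rightarrow> weight" where
  "pos_root n i j = eps n i - eps n j"

definition pairs :: "nat \<Rightarrow> (nat \<times> nat) set" where
  "pairs n = {(i, j). i < j \<and> j < n}"

text \<open>
  The fundamental coweight dual to the \<open>k\<close>-th simple root: the projection to the first \<open>k + 1\<close>
  coordinates, shifted by a scalar matrix to have trace zero. Evaluating a weight at it reads off the
  \<open>k\<close>-th simple-root coordinate.
\<close>
definition coweight :: "nat \<Rightarrow> nat \<Rightarrow> complex mat" where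
  "coweight n k =
     mat n n (\<lambda>(i, j). if i = j then of_bool (i \<le> k) - of_nat (Suc k) / of_nat n else 0)"

lemma finite_pairs: "finite (pairs n)"
  by (rule finite_subset[of _ "{..<n} \<times> {..<n}"]) (auto simp: pairs_def)

lemma coweight_in_cartan:
  assumes "k < n"
  shows "coweight n k \<in> cartan n"
proof -
  have "(\<Sum>i<n. of_bool (i \<le> k) :: complex) = (\<Sum>i\<in>{..k}. 1)"
    using assms by (intro sum.mono_neutral_cong_right) auto
  then have "(\<Sum>i<n. of_bool (i \<le> k) - of_nat (Suc k) / of_nat n :: complex) = 0"
    using assms by (simp add: sum_subtractf del: of_bool_eq)
  then show ?thesis
    by (simp add: cartan_def coweight_def diagonal_mat_def)
qed

lemma pos_root_coweight:
  assumes "i < j" "j < n" "k < n"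
  shows "pos_root n i j (coweight n k) = of_bool (i \<le> k \<and> k < j)"
  using assms coweight_in_cartan[of k n] by (auto simp: pos_root_def eps_def) (auto simp: coweight_def)

text \<open>
  Because the functionals \<open>eps n i\<close> are linearly dependent, distinctness of the positive roots needs
  an argument: evaluation at the coweights recovers the interval \<open>{i..<j}\<close>. It allows sums over the
  set of positive roots to be written as sums over index pairs.
\<close>
lemma inj_on_pos_root: "inj_on (\<lambda>(i, j). pos_root n i j) (pairs n)"
proof -
  have "i = i' \<and> j = j'"
    if ij: "i < j" "j < n" "i' < j'" "j' < n" and eq: "pos_root n i j = pos_root n i' j'" for i j i' j'
  proof -
    have *: "(i \<le> k \<and> k < j) \<longleftrightarrow> (i' \<le> k \<and> k < j')" if "k < n" for k
    proof -
      have "(of_bool (i \<le> k \<and> k < j) :: complex) = of_bool (i' \<le> k \<and> k < j')"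
        using ij that eq pos_root_coweight[of i j n k] pos_root_coweight[of i' j' n k] by metis
      then show ?thesis by (simp only: of_bool_eq_iff)
    qed
    from *[of i] *[of i'] *[of "j - 1"] *[of "j' - 1"] ij show ?thesis
      by (cases j; cases j') auto
  qed
  then show ?thesis unfolding inj_on_def pairs_def by auto
qed

lemma pos_roots_eq: "pos_roots n = (\<lambda>(i, j). pos_root n i j) ` pairs n"
  by (auto simp: pos_roots_def pos_root_def pairs_def image_def)

lemma sum_pos_roots: "(\<Sum>\<beta>\<in>pos_roots n. f \<beta>) = (\<Sum>(i, j)\<in>pairs n. f (pos_root n i j))"
  unfolding pos_roots_eq by (subst sum.reindex[OF inj_on_pos_root]) (auto intro: sum.cong)

lemma pos_root_eq_sum_simple_roots: "i \<le> j \<Longrightarrow> pos_root n i j = (\<Sum>k\<in>{i..<j}. pos_root n k (Suc k))"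
proof (induction rule: dec_induct)
  case base
  then show ?case by (simp add: pos_root_def)
next
  case (step l)
  have "pos_root n i (Suc l) = pos_root n i l + pos_root n l (Suc l)"
    by (simp add: pos_root_def fun_eq_iff)
  then show ?case using step by simp
qed

lemma sum_simple_roots_coweight:
  assumes "J \<subseteq> {..<n - 1}" "k < n - 1"
  shows "(\<Sum>l\<in>J. pos_root n l (Suc l)) (coweight n k) = of_bool (k \<in> J)"
proof -
  have fin: "finite J" using assms(1) finite_subset by blast
  have "(\<Sum>l\<in>J. pos_root n l (Suc l)) (coweight n k) = (\<Sum>l\<in>J. of_bool (l = k))"
    unfolding sum_weight_apply
    by (intro sum.cong refl, subst pos_root_coweight) (use assms in auto)
  also have "\<dots> = of_bool (k \<in> J)"
    using fin by (simp add: of_bool_def)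
  finally show ?thesis .
qed

text \<open>
  Every root is the sum of the simple roots in its interval, so after an exchange of summations the
  coefficient of the \<open>k\<close>-th simple root counts the intervals through \<open>k\<close>.
\<close>
lemma sum_roots_eq:
  "(\<Sum>(i, j)\<in>pairs n. scale_weight (of_nat (M i j)) (pos_root n i j)) =
   (\<Sum>k<n - 1. scale_weight (of_nat (\<Sum>(i, j)\<in>{(i, j) \<in> pairs n. i \<le> k \<and> k < j}. M i j))
      (pos_root n k (Suc k)))"
proof
  fix H
  let ?s = "\<lambda>k. pos_root n k (Suc k) H"
  have "(\<Sum>(i, j)\<in>pairs n. of_nat (M i j) * pos_root n i j H) =
      (\<Sum>(i, j)\<in>pairs n. \<Sum>k<n - 1. if i \<le> k \<and> k < j then of_nat (M i j) * ?s k else 0)"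
  proof (intro sum.cong refl, clarify)
    fix i j assume "(i, j) \<in> pairs n"
    then have ij: "i < j" "j < n" by (auto simp: pairs_def)
    have "pos_root n i j H = (\<Sum>k\<in>{i..<j}. ?s k)"
      using pos_root_eq_sum_simple_roots[of i j n] ij by (simp add: sum_weight_apply)
    then have "of_nat (M i j) * pos_root n i j H = (\<Sum>k\<in>{i..<j}. of_nat (M i j) * ?s k)"
      by (simp only: sum_distrib_left)
    also have "\<dots> = (\<Sum>k<n - 1. if i \<le> k \<and> k < j then of_nat (M i j) * ?s k else 0)"
      using ij by (intro sum.mono_neutral_cong_left) auto
    finally show "of_nat (M i j) * pos_root n i j H = \<dots>" .
  qed
  also have "\<dots> = (\<Sum>k<n - 1. \<Sum>(i, j)\<in>pairs n. if i \<le> k \<and> k < j then of_nat (M i j) * ?s k else 0)"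
    by (subst sum.swap) (simp add: case_prod_unfold)
  also have "\<dots> = (\<Sum>k<n - 1. of_nat (\<Sum>(i, j)\<in>{(i, j) \<in> pairs n. i \<le> k \<and> k < j}. M i j) * ?s k)"
  proof (intro sum.cong refl)
    fix k
    have "(\<Sum>(i, j)\<in>pairs n. if i \<le> k \<and> k < j then of_nat (M i j) * ?s k else 0) =
      (\<Sum>(i, j)\<in>{(i, j) \<in> pairs n. i \<le> k \<and> k < j}. of_nat (M i j) * ?s k)"
      by (intro sum.mono_neutral_cong_right finite_pairs) (auto split: if_splits)
    then show "(\<Sum>(i, j)\<in>pairs n. if i \<le> k \<and> k < j then of_nat (M i j) * ?s k else 0) =
      of_nat (\<Sum>(i, j)\<in>{(i, j) \<in> pairs n. i \<le> k \<and> k < j}. M i j) * ?s k"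
      by (simp only: of_nat_sum sum_distrib_right case_prod_unfold)
  qed
  finally show "(\<Sum>(i, j)\<in>pairs n. scale_weight (of_nat (M i j)) (pos_root n i j)) H =
    (\<Sum>k<n - 1. scale_weight (of_nat (\<Sum>(i, j)\<in>{(i, j) \<in> pairs n. i \<le> k \<and> k < j}. M i j))
      (pos_root n k (Suc k))) H"
    unfolding sum_weight_apply scale_weight_def case_prod_unfold by simp
qed

lemma kostant_partition_coweight:
  assumes "m \<in> kostant_partitions n \<xi> d" "k < n"
  shows "\<xi> (coweight n k) = of_nat (\<Sum>(i, j)\<in>{(i, j) \<in> pairs n. i \<le> k \<and> k < j}. m (pos_root n i j))"
proof -
  have "\<xi> = (\<Sum>(i, j)\<in>pairs n. scale_weight (of_nat (m (pos_root n i j))) (pos_root n i j))"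
    using assms(1) by (simp add: kostant_partitions_def sum_pos_roots)
  then have "\<xi> (coweight n k) =
      (\<Sum>(i, j)\<in>pairs n. of_nat (m (pos_root n i j)) * pos_root n i j (coweight n k))"
    by (simp add: sum_weight_apply scale_weight_def case_prod_unfold)
  also have "\<dots> = (\<Sum>(i, j)\<in>{(i, j) \<in> pairs n. i \<le> k \<and> k < j}. of_nat (m (pos_root n i j)))"
    by (intro sum.mono_neutral_cong_right finite_pairs)
      (use pos_root_coweight[of _ _ n k] assms(2) in \<open>auto simp: pairs_def\<close>)
  finally show ?thesis by (simp add: case_prod_unfold)
qed

text \<open>
  This turns Kostant partitions into a purely combinatorial object. The simple-root coordinates of
  both sides are compared with the coweights in one direction and with \<open>sum_roots_eq\<close> in the other.
\<close>
lemma kostant_partitions_simple_sum_iff: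
  assumes "J \<subseteq> {..<n - 1}"
  shows "m \<in> kostant_partitions n (\<Sum>k\<in>J. pos_root n k (Suc k)) d \<longleftrightarrow>
    m \<in> pos_roots n \<rightarrow>\<^sub>E UNIV \<and>
    (\<forall>k<n - 1. (\<Sum>(i, j)\<in>{(i, j) \<in> pairs n. i \<le> k \<and> k < j}. m (pos_root n i j)) = of_bool (k \<in> J)) \<and>
    (\<Sum>(i, j)\<in>pairs n. m (pos_root n i j)) = d" (is "?L \<longleftrightarrow> ?R")
proof
  assume m: ?L
  have "(\<Sum>(i, j)\<in>{(i, j) \<in> pairs n. i \<le> k \<and> k < j}. m (pos_root n i j)) = of_bool (k \<in> J)" (is "?x = _")
    if k: "k < n - 1" for k
  proof -
    have "(of_nat ?x :: complex) = of_nat (of_bool (k \<in> J))"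
      using kostant_partition_coweight[OF m, of k] sum_simple_roots_coweight[OF assms k] k
      by simp
    then show ?thesis by (simp only: of_nat_eq_iff)
  qed
  with m show ?R by (auto simp: kostant_partitions_def sum_pos_roots)
next
  assume R: ?R
  have "(\<Sum>\<beta>\<in>pos_roots n. scale_weight (of_nat (m \<beta>)) \<beta>) =
      (\<Sum>k<n - 1. scale_weight (of_bool (k \<in> J)) (pos_root n k (Suc k)))"
    using R unfolding sum_pos_roots by (subst sum_roots_eq) (auto intro!: sum.cong)
  also have "\<dots> = (\<Sum>k\<in>J. pos_root n k (Suc k))"
    using assms by (intro sum.mono_neutral_cong_right) (auto simp: scale_weight_def fun_eq_iff)
  finally show ?L using R by (auto simp: kostant_partitions_def sum_pos_roots)
qed

section \<open>The weight attached to a Weyl group element\<close>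

text \<open>
  The half sum of the positive roots is \<open>\<Sum>i<n. ((n - 1) / 2 - i) eps n i\<close>, and the constant
  \<open>(n - 1) / 2\<close> multiplies the trace, which is zero.
\<close>
lemma rho_apply:
  assumes "H \<in> cartan n"
  shows "rho n H = - (\<Sum>i<n. of_nat i * H $$ (i, i))"
proof -
  have *: "(\<Sum>(i, j)\<in>pairs k. h i - h j) = (\<Sum>i<k. (of_nat k - 1 - 2 * of_nat i) * h i)"
    for h :: "nat \<Rightarrow> complex" and k
  proof (induction k)
    case 0
    then show ?case by (simp add: pairs_def)
  next
    case (Suc k)
    have P: "pairs (Suc k) = pairs k \<union> (\<lambda>i. (i, k)) ` {..<k}"
      by (auto simp: pairs_def)
    have "(\<Sum>(i, j)\<in>pairs (Suc k). h i - h j) =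
        (\<Sum>(i, j)\<in>pairs k. h i - h j) + (\<Sum>i<k. h i - h k)"
      unfolding P
      by (subst sum.union_disjoint) (use finite_pairs[of k] in \<open>auto simp: pairs_def sum.reindex inj_on_def\<close>)
    also have "\<dots> = (\<Sum>i<k. (of_nat k - 1 - 2 * of_nat i) * h i) + (\<Sum>i<k. h i) - of_nat k * h k"
      using Suc by (simp add: sum_subtractf)
    also have "\<dots> = (\<Sum>i<Suc k. (of_nat (Suc k) - 1 - 2 * of_nat i) * h i)"
      by (simp add: sum.distrib[symmetric] algebra_simps)
    finally show ?case .
  qed
  have "rho n H = 1 / 2 * (\<Sum>(i, j)\<in>pairs n. H $$ (i, i) - H $$ (j, j))"
    unfolding rho_def scale_weight_def sum_weight_apply sum_pos_roots
    using assms by (simp add: pos_root_def eps_def case_prod_unfold)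
  also have "\<dots> = 1 / 2 * (\<Sum>i<n. (of_nat n - 1) * H $$ (i, i) - 2 * (of_nat i * H $$ (i, i)))"
    by (subst *) (simp add: algebra_simps)
  also have "\<dots> = 1 / 2 * ((of_nat n - 1) * (\<Sum>i<n. H $$ (i, i)) - 2 * (\<Sum>i<n. of_nat i * H $$ (i, i)))"
    by (simp only: sum_subtractf sum_distrib_left)
  also have "\<dots> = - (\<Sum>i<n. of_nat i * H $$ (i, i))"
    using assms by (simp add: cartan_def)
  finally show ?thesis .
qed

text \<open>
  On trace-zero matrices \<open>highest_root n + rho n\<close> is minus the combination of the \<open>eps n i\<close> with
  these coefficients, which are \<open>-1, 1, 2, \<dots>, n - 2, n\<close> if \<open>n \<ge> 2\<close>.
\<close>
definition neg_exponent :: "nat \<Rightarrow> nat \<Rightarrow> int" where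
  "neg_exponent n i = int i - of_bool (i = 0) + of_bool (Suc i = n)"

lemma highest_root_plus_rho_apply:
  assumes "n \<ge> 1" "H \<in> cartan n"
  shows "(highest_root n + rho n) H = - (\<Sum>i<n. of_int (neg_exponent n i) * H $$ (i, i))"
proof -
  have "(\<Sum>i<n. of_int (neg_exponent n i) * H $$ (i, i)) =
      (\<Sum>i<n. of_nat i * H $$ (i, i) - (if i = 0 then H $$ (i, i) else 0)
        + (if i = n - 1 then H $$ (i, i) else 0))"
    using assms(1) by (intro sum.cong) (auto simp: neg_exponent_def algebra_simps)
  also have "\<dots> = (\<Sum>i<n. of_nat i * H $$ (i, i)) - H $$ (0, 0) + H $$ (n - 1, n - 1)"
    using assms(1) by (simp add: sum.distrib sum_subtractf)
  finally show ?thesis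
    using assms by (simp add: rho_apply highest_root_def eps_def)
qed

definition kostant_weight :: "nat \<Rightarrow> (nat \<Rightarrow> nat) \<Rightarrow> weight" where
  "kostant_weight n \<sigma> = weyl_act n \<sigma> (highest_root n + rho n) - (0 + rho n)"

lemma kostant_weight_apply:
  assumes n: "n \<ge> 1" and \<sigma>: "\<sigma> permutes {..<n}" and H: "H \<in> cartan n"
  shows "kostant_weight n \<sigma> H = (\<Sum>i<n. of_int (int i - neg_exponent n (inv_into UNIV \<sigma> i)) * H $$ (i, i))"
proof -
  let ?H = "mat n n (\<lambda>(i, j). H $$ (\<sigma> i, \<sigma> j))"
  have "weyl_act n \<sigma> (highest_root n + rho n) H = (highest_root n + rho n) ?H"
    using H by (simp add: weyl_act_def)
  also have "\<dots> = - (\<Sum>i<n. of_int (neg_exponent n i) * H $$ (\<sigma> i, \<sigma> i))"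
    using highest_root_plus_rho_apply[OF n weyl_permuted_in_cartan[OF \<sigma> H]] by simp
  also have "\<dots> = - (\<Sum>i<n. of_int (neg_exponent n (inv_into UNIV \<sigma> i)) * H $$ (i, i))"
    using sum.permute[OF permutes_inv[OF \<sigma>],
        of "\<lambda>i. of_int (neg_exponent n i) * H $$ (\<sigma> i, \<sigma> i)"] permutes_inverses[OF \<sigma>]
    by (simp add: o_def)
  finally show ?thesis
    by (simp add: kostant_weight_def rho_apply[OF H] left_diff_distrib sum_subtractf)
qed

text \<open>
  The two corrections at the ends cancel, so the coefficients of \<open>kostant_weight n \<sigma>\<close> sum to zero.
  This makes the scalar shift in the coweights harmless.
\<close>
lemma sum_neg_exponent:
  assumes "n \<ge> 1"
  shows "(\<Sum>i<n. neg_exponent n i) = (\<Sum>i<n. int i)"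
proof -
  have "(\<Sum>i<n. neg_exponent n i) =
      (\<Sum>i<n. int i - (if i = 0 then 1 else 0) + (if i = n - 1 then 1 else 0))"
    using assms by (intro sum.cong) (auto simp: neg_exponent_def)
  then show ?thesis using assms by (simp add: sum.distrib sum_subtractf)
qed

lemma kostant_weight_coweight:
  assumes k: "k < n" and \<sigma>: "\<sigma> permutes {..<n}"
  shows "kostant_weight n \<sigma> (coweight n k) = of_int (\<Sum>i\<le>k. int i - neg_exponent n (inv_into UNIV \<sigma> i))"
proof -
  define e where "e i = int i - neg_exponent n (inv_into UNIV \<sigma> i)" for i
  have tot: "(\<Sum>i<n. e i) = 0"
    using sum.permute[OF permutes_inv[OF \<sigma>], of "neg_exponent n"] sum_neg_exponent[of n] k
    by (simp add: e_def o_def sum_subtractf)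
  have "kostant_weight n \<sigma> (coweight n k) =
      (\<Sum>i<n. of_int (e i) * (of_bool (i \<le> k) - of_nat (Suc k) / of_nat n))"
    using kostant_weight_apply[OF _ \<sigma> coweight_in_cartan[OF k]] k by (simp add: coweight_def e_def)
  also have "\<dots> = (\<Sum>i<n. of_int (e i) * of_bool (i \<le> k)) -
      of_int (\<Sum>i<n. e i) * (of_nat (Suc k) / of_nat n)"
    by (simp only: right_diff_distrib sum_subtractf sum_distrib_right of_int_sum)
  also have "\<dots> = (\<Sum>i<n. of_int (e i) * of_bool (i \<le> k))"
    unfolding tot by simp
  also have "\<dots> = (\<Sum>i\<le>k. of_int (e i))"
    using k by (intro sum.mono_neutral_cong_right) auto
  finally show ?thesis by (simp add: e_def)
qed

section \<open>Tilings by intervals\<close>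

text \<open>
  The sets that can occur as left endpoints in a tiling of \<open>J\<close> by disjoint intervals: a new interval
  must start wherever a run of consecutive elements of \<open>J\<close> starts.
\<close>
definition left_end_sets :: "nat set \<Rightarrow> nat set set" where
  "left_end_sets J = {S. S \<subseteq> J \<and> (\<forall>k\<in>J. k = 0 \<or> k - 1 \<notin> J \<longrightarrow> k \<in> S)}"

text \<open>
  The tiling of \<open>J\<close> with left endpoints \<open>S\<close>: an interval \<open>{i..<j}\<close> starts in \<open>S\<close> and is
  extended as far as possible, until it meets the next element of \<open>S\<close> or leaves \<open>J\<close>.
\<close>
definition blocks :: "nat set \<Rightarrow> nat set \<Rightarrow> (nat \<times> nat) set" where
  "blocks J S = {(i, j). i < j \<and> i \<in> S \<and> {i..<j} \<subseteq> J \<and> {i<..<j} \<inter> S = {} \<and> (j \<in> J \<longrightarrow> j \<in> S)}"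

lemma block_right_end_unique:
  assumes "(i, j) \<in> blocks J S" "(i, j') \<in> blocks J S"
  shows "j = j'"
proof (rule ccontr)
  assume "j \<noteq> j'"
  have "j \<in> J \<and> j \<in> {i<..<j'}" if "j < j'" "(i, j) \<in> blocks J S" "(i, j') \<in> blocks J S" for j j'
    using that by (auto simp: blocks_def)
  then have "\<not> j < j'" "\<not> j' < j" using assms by (auto simp: blocks_def)
  with \<open>j \<noteq> j'\<close> show False by simp
qed

lemma block_starting_at:
  assumes "finite J" "S \<subseteq> J" "i \<in> S"
  shows "\<exists>j. (i, j) \<in> blocks J S"
proof -
  define P where "P j \<longleftrightarrow> i < j \<and> (j \<in> S \<or> j \<notin> J)" for j
  \<comment> \<open>The right endpoint is the first place after \<open>i\<close> where the interval has to stop.\<close>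
  obtain b where "J \<subseteq> {..<b}"
    using assms(1) finite_nat_iff_bounded by blast
  then have "P (max b (Suc i))" by (auto simp: P_def)
  then have "P (LEAST j. P j)" by (rule LeastI)
  moreover have "\<not> P l" if "l < (LEAST j. P j)" for l
    using that by (rule not_less_Least)
  ultimately obtain j where j: "P j" and least: "\<And>l. l < j \<Longrightarrow> \<not> P l" by blast
  have "l \<in> J \<and> (i < l \<longrightarrow> l \<notin> S)" if "i \<le> l" "l < j" for l
    using least[OF that(2)] that(1) assms(2,3) by (cases "l = i") (auto simp: P_def)
  then have "(i, j) \<in> blocks J S"
    using j assms(3) by (auto simp: blocks_def P_def)
  then show ?thesis ..
qed

text \<open>
  Induction from left to right: either an interval starts at \<open>Suc k\<close>, or \<open>Suc k\<close> is not the
  start of a run, so that \<open>k\<close> is in \<open>J\<close> and the interval through \<open>k\<close> extends to \<open>Suc k\<close>.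
\<close>
lemma block_containing:
  assumes "finite J" "S \<in> left_end_sets J" "k \<in> J"
  shows "\<exists>i j. (i, j) \<in> blocks J S \<and> i \<le> k \<and> k < j"
  using assms(3)
proof (induction k)
  case 0
  then have "0 \<in> S" using assms(2) by (auto simp: left_end_sets_def)
  with block_starting_at[of J S 0] assms show ?case
    by (auto simp: left_end_sets_def blocks_def)
next
  case (Suc k)
  show ?case
  proof (cases "Suc k \<in> S")
    case True
    with block_starting_at[of J S "Suc k"] assms show ?thesis
      by (auto simp: left_end_sets_def blocks_def)
  next
    case False
    then have "k \<in> J" using assms(2) Suc.prems by (auto simp: left_end_sets_def)
    with Suc.IH obtain i j where ij: "(i, j) \<in> blocks J S" "i \<le> k" "k < j" by blast
    moreover have "j \<noteq> Suc k"
      using ij(1) False Suc.prems by (auto simp: blocks_def)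
    ultimately show ?thesis by (metis Suc_lessI le_Suc_eq)
  qed
qed

lemma block_containing_unique:
  assumes "(i, j) \<in> blocks J S" "i \<le> k" "k < j" "(i', j') \<in> blocks J S" "i' \<le> k" "k < j'"
  shows "(i, j) = (i', j')"
proof -
  have "i = i'"
  proof (rule ccontr)
    assume "i \<noteq> i'"
    then have "i' \<in> {i<..<j} \<or> i \<in> {i'<..<j'}"
      using assms(2,3,5,6) by auto
    with assms(1,4) show False unfolding blocks_def by blast
  qed
  with assms(1,4) block_right_end_unique[of i j J S j'] show ?thesis by simp
qed

lemma blocks_subset_pairs:
  assumes "J \<subseteq> {..<n - 1}"
  shows "blocks J S \<subseteq> pairs n"
proof clarify
  fix i j assume b: "(i, j) \<in> blocks J S"
  then have "j - 1 \<in> {i..<j}" "{i..<j} \<subseteq> J" by (auto simp: blocks_def)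
  then have "j - 1 < n - 1" using assms by blast
  with b show "(i, j) \<in> pairs n" by (auto simp: blocks_def pairs_def)
qed

lemma sum_blocks_cover:
  assumes J: "J \<subseteq> {..<n - 1}" and S: "S \<in> left_end_sets J"
  shows "(\<Sum>(i, j)\<in>{(i, j) \<in> pairs n. i \<le> k \<and> k < j}. of_bool ((i, j) \<in> blocks J S)) =
    (of_bool (k \<in> J) :: nat)" (is "?s = _")
proof -
  have fin: "finite {(i, j) \<in> pairs n. i \<le> k \<and> k < j}"
    by (rule finite_subset[OF _ finite_pairs[of n]]) auto
  show ?thesis
  proof (cases "k \<in> J")
    case True
    obtain i j where ij: "(i, j) \<in> blocks J S" "i \<le> k" "k < j"
      using block_containing[OF _ S True] finite_subset[OF J] by auto
    have only: "(i', j') \<in> blocks J S \<longleftrightarrow> i' = i \<and> j' = j"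
      if "i' \<le> k" "k < j'" for i' j'
      using block_containing_unique[OF ij, of i' j'] ij(1) that by blast
    have "?s = (\<Sum>(i', j')\<in>{(i, j)}. 1)"
      using ij blocks_subset_pairs[OF J, of S]
      by (intro sum.mono_neutral_cong_right fin) (auto simp: only)
    then show ?thesis using True by simp
  next
    case False
    have "?s = 0"
      by (rule sum.neutral) (use False in \<open>force simp: blocks_def\<close>)
    then show ?thesis using False by simp
  qed
qed

lemma sum_blocks_total:
  assumes J: "J \<subseteq> {..<n - 1}" and S: "S \<subseteq> J"
  shows "(\<Sum>(i, j)\<in>pairs n. of_bool ((i, j) \<in> blocks J S)) = card S"
proof -
  have "finite J" using finite_subset[OF J] by simp
  have "(\<Sum>(i, j)\<in>pairs n. of_bool ((i, j) \<in> blocks J S)) = card (blocks J S)"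
  proof -
    have "(\<Sum>p\<in>pairs n. of_bool (p \<in> blocks J S)) = (\<Sum>p\<in>blocks J S. 1::nat)"
      by (intro sum.mono_neutral_cong_right finite_pairs blocks_subset_pairs J) auto
    then show ?thesis by (simp add: case_prod_unfold)
  qed
  also have "\<dots> = card (fst ` blocks J S)"
    by (rule card_image[symmetric], rule inj_onI, clarsimp) (rule block_right_end_unique)
  also have "fst ` blocks J S = S"
  proof
    show "fst ` blocks J S \<subseteq> S" by (auto simp: blocks_def)
    show "S \<subseteq> fst ` blocks J S"
    proof
      fix i assume "i \<in> S"
      then obtain j where "(i, j) \<in> blocks J S" using block_starting_at[OF \<open>finite J\<close> S] by blast
      then show "i \<in> fst ` blocks J S" by (rule image_eqI[rotated]) simp
    qed
  qed
  finally show ?thesis .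
qed

text \<open>
  The converse to \<open>sum_blocks_cover\<close>. Since every point is covered at most once, multiplicities are
  0 or 1 and two chosen intervals sharing a point coincide. So a chosen interval contains no further
  left endpoint; and if its right end \<open>j\<close> lies in \<open>J\<close>, then the interval covering \<open>j\<close> must
  start there, for otherwise it would share the point \<open>j - 1\<close>.
\<close>
lemma tiling_multiplicity_eq_blocks:
  fixes M :: "nat \<Rightarrow> nat \<Rightarrow> nat"
  assumes J: "J \<subseteq> {..<n - 1}"
    and cover: "\<And>k. k < n - 1 \<Longrightarrow>
      (\<Sum>(i, j)\<in>{(i, j) \<in> pairs n. i \<le> k \<and> k < j}. M i j) = of_bool (k \<in> J)"
  defines "S \<equiv> {i. \<exists>j. (i, j) \<in> pairs n \<and> M i j \<noteq> 0}"
  shows "S \<in> left_end_sets J"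
    and "(i, j) \<in> pairs n \<Longrightarrow> M i j = of_bool ((i, j) \<in> blocks J S)"
proof -
  let ?C = "\<lambda>k. {(i, j) \<in> pairs n. i \<le> k \<and> k < j}"
  have fin: "finite (?C k)" for k
    by (rule finite_subset[OF _ finite_pairs[of n]]) auto
  have inJ: "k \<in> J" if "(i, j) \<in> ?C k" "M i j \<noteq> 0" for i j k
  proof (rule ccontr)
    assume "k \<notin> J"
    moreover have "k < n - 1" using that(1) by (auto simp: pairs_def)
    ultimately have "(\<Sum>(i, j)\<in>?C k. M i j) = 0" using cover by simp
    then show False using that fin[of k] by (auto simp: case_prod_unfold)
  qed
  have ex1: "\<exists>i j. (i, j) \<in> ?C k \<and> M i j = 1 \<and>
      (\<forall>i' j'. (i', j') \<in> ?C k \<longrightarrow> M i' j' \<noteq> 0 \<longrightarrow> i' = i \<and> j' = j)" if "k \<in> J" for k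
  proof -
    have "(\<Sum>p\<in>?C k. M (fst p) (snd p)) = 1"
      using cover[of k] that J by (auto simp: case_prod_unfold)
    then show ?thesis
      unfolding sum_eq_1_iff[OF fin] by (fastforce simp: case_prod_unfold)
  qed
  have uniq: "i = i' \<and> j = j'"
    if "(i, j) \<in> ?C k" "M i j \<noteq> 0" "(i', j') \<in> ?C k" "M i' j' \<noteq> 0" for i j i' j' k
    using ex1[OF inJ[OF that(1,2)]] that by blast
  have SJ: "S \<subseteq> J"
    using inJ by (fastforce simp: S_def pairs_def)
  have start: "k \<in> S" if k: "k \<in> J" and "k = 0 \<or> k - 1 \<notin> J" for k
  proof -
    obtain i j where ij: "(i, j) \<in> ?C k" "M i j = 1" using ex1[OF k] by blast
    have "i = k"
    proof (rule ccontr)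
      assume "i \<noteq> k"
      with ij have "(i, j) \<in> ?C (k - 1)" "k \<noteq> 0" by auto
      then show False using inJ[of i j "k - 1"] ij(2) that(2) by simp
    qed
    then show ?thesis using ij by (auto simp: S_def)
  qed
  show "S \<in> left_end_sets J"
    using SJ start by (auto simp: left_end_sets_def)
  have block: "(i, j) \<in> blocks J S" if p: "(i, j) \<in> pairs n" and nz: "M i j \<noteq> 0" for i j
  proof -
    have "i < j" using p by (simp add: pairs_def)
    have "i \<in> S" using p nz by (auto simp: S_def)
    have "{i..<j} \<subseteq> J" using inJ[of i j] p nz by auto
    have "k \<notin> S" if "k \<in> {i<..<j}" for k
    proof
      assume "k \<in> S"
      then obtain l where "(k, l) \<in> pairs n" "M k l \<noteq> 0" by (auto simp: S_def)
      then have "(k, l) \<in> ?C k" by (auto simp: pairs_def)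
      with uniq[of i j k k l] \<open>M k l \<noteq> 0\<close> p nz that show False by auto
    qed
    moreover have "j \<in> S" if jJ: "j \<in> J"
    proof -
      obtain i' j' where ij': "(i', j') \<in> ?C j" "M i' j' = 1" using ex1[OF jJ] by blast
      have "i' = j"
      proof (rule ccontr)
        assume "i' \<noteq> j"
        then have "(i', j') \<in> ?C (j - 1)" "(i, j) \<in> ?C (j - 1)"
          using ij' p \<open>i < j\<close> by auto
        then have "j' = j" using uniq[of i j "j - 1" i' j'] nz ij'(2) by simp
        then show False using ij' by simp
      qed
      then show ?thesis using ij' by (auto simp: S_def)
    qed
    ultimately show ?thesis
      using \<open>i < j\<close> \<open>i \<in> S\<close> \<open>{i..<j} \<subseteq> J\<close> by (auto simp: blocks_def)
  qed
  show "M i j = of_bool ((i, j) \<in> blocks J S)" if p: "(i, j) \<in> pairs n"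
  proof (cases "M i j = 0")
    case False
    have "(i, j) \<in> ?C i" using p by (auto simp: pairs_def)
    moreover have "i \<in> J" using False p SJ by (auto simp: S_def)
    ultimately have "M i j = 1" using ex1[of i] False by blast
    then show ?thesis using block[OF p] by simp
  next
    case True
    have "(i, j) \<notin> blocks J S"
    proof
      assume b: "(i, j) \<in> blocks J S"
      then have "i \<in> S" by (auto simp: blocks_def)
      then obtain l where "(i, l) \<in> pairs n" "M i l \<noteq> 0" by (auto simp: S_def)
      then have "l = j" using block block_right_end_unique[OF b, of l] by simp
      with \<open>M i l \<noteq> 0\<close> True show False by simp
    qed
    then show ?thesis using True by simp
  qed
qed

text \<open>
  The bijection sends a set of left endpoints to the indicator function of its tiling, and a
  partition to the left endpoints of the roots occurring in it.
\<close>
lemma card_kostant_partitions_simple_sum: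
  assumes J: "J \<subseteq> {..<n - 1}"
  shows "card (kostant_partitions n (\<Sum>k\<in>J. pos_root n k (Suc k)) d) =
    card {S \<in> left_end_sets J. card S = d}"
proof -
  let ?K = "kostant_partitions n (\<Sum>k\<in>J. pos_root n k (Suc k)) d"
  define ind where "ind S = (\<lambda>\<beta>\<in>pos_roots n. of_bool (\<exists>(i, j)\<in>blocks J S. \<beta> = pos_root n i j) :: nat)"
    for S
  define starts where "starts m = {i. \<exists>j. (i, j) \<in> pairs n \<and> m (pos_root n i j) \<noteq> (0::nat)}" for m
  have pr: "pos_root n i j \<in> pos_roots n" if "(i, j) \<in> pairs n" for i j
    using that by (force simp: pos_roots_eq)
  have ind: "ind S (pos_root n i j) = of_bool ((i, j) \<in> blocks J S)" if p: "(i, j) \<in> pairs n" for S i j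
  proof -
    have "a = i \<and> b = j" if "(a, b) \<in> blocks J S" "pos_root n i j = pos_root n a b" for a b
      using inj_onD[OF inj_on_pos_root[of n], of "(i, j)" "(a, b)"] that p
        blocks_subset_pairs[OF J, of S] by auto
    then have "(\<exists>(a, b)\<in>blocks J S. pos_root n i j = pos_root n a b) \<longleftrightarrow> (i, j) \<in> blocks J S"
      by blast
    then show ?thesis using pr[OF p] by (simp only: ind_def restrict_apply if_True)
  qed
  have fin: "finite J" using finite_subset[OF J] by simp
  note iff = kostant_partitions_simple_sum_iff[OF J]
  have ext: "m \<in> pos_roots n \<rightarrow>\<^sub>E UNIV"
    and cover: "\<And>k. k < n - 1 \<Longrightarrow>
      (\<Sum>(i, j)\<in>{(i, j) \<in> pairs n. i \<le> k \<and> k < j}. m (pos_root n i j)) = of_bool (k \<in> J)"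
    and total: "(\<Sum>(i, j)\<in>pairs n. m (pos_root n i j)) = d" if "m \<in> ?K" for m
    using that[unfolded iff] by blast+
  have starts: "starts m \<in> left_end_sets J" if "m \<in> ?K" for m
    using tiling_multiplicity_eq_blocks(1)[OF J cover[OF that]] by (simp only: starts_def)
  have blocks: "m (pos_root n i j) = of_bool ((i, j) \<in> blocks J (starts m))"
    if "m \<in> ?K" "(i, j) \<in> pairs n" for m i j
    using tiling_multiplicity_eq_blocks(2)[OF J cover[OF that(1)] that(2)] by (simp only: starts_def)
  have "bij_betw ind {S \<in> left_end_sets J. card S = d} ?K"
  proof (rule bij_betw_byWitness[where f' = starts])
    show "\<forall>S\<in>{S \<in> left_end_sets J. card S = d}. starts (ind S) = S"
    proof clarify
      fix S assume "S \<in> left_end_sets J"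
      then have "S \<subseteq> J" by (simp add: left_end_sets_def)
      have "i \<in> starts (ind S) \<longleftrightarrow> i \<in> S" for i
      proof -
        have "i \<in> starts (ind S) \<longleftrightarrow> (\<exists>j. (i, j) \<in> pairs n \<and> (i, j) \<in> blocks J S)"
          unfolding starts_def using ind by auto
        also have "\<dots> \<longleftrightarrow> (\<exists>j. (i, j) \<in> blocks J S)"
          using blocks_subset_pairs[OF J, of S] by blast
        also have "\<dots> \<longleftrightarrow> i \<in> S"
          using block_starting_at[OF fin \<open>S \<subseteq> J\<close>] by (auto simp: blocks_def[of J S])
        finally show ?thesis .
      qed
      then show "starts (ind S) = S" by blast
    qed
    show "\<forall>m\<in>?K. ind (starts m) = m"
    proof
      fix m assume m: "m \<in> ?K"
      show "ind (starts m) = m"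
      proof
        fix \<beta>
        show "ind (starts m) \<beta> = m \<beta>"
        proof (cases "\<beta> \<in> pos_roots n")
          case True
          then obtain i j where "(i, j) \<in> pairs n" "\<beta> = pos_root n i j"
            by (auto simp: pos_roots_eq)
          then show ?thesis using blocks[OF m] ind by simp
        next
          case False
          then show ?thesis using PiE_arb[OF ext[OF m]] by (simp add: ind_def)
        qed
      qed
    qed
    show "ind ` {S \<in> left_end_sets J. card S = d} \<subseteq> ?K"
    proof (rule image_subsetI)
      fix S assume "S \<in> {S \<in> left_end_sets J. card S = d}"
      then have S: "S \<in> left_end_sets J" and d: "card S = d" by auto
      have "(\<Sum>(i, j)\<in>{(i, j) \<in> pairs n. i \<le> k \<and> k < j}. ind S (pos_root n i j)) =
          (\<Sum>(i, j)\<in>{(i, j) \<in> pairs n. i \<le> k \<and> k < j}. of_bool ((i, j) \<in> blocks J S))" for k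
        by (rule sum.cong[OF refl]) (use ind in auto)
      moreover have "(\<Sum>(i, j)\<in>pairs n. ind S (pos_root n i j)) =
          (\<Sum>(i, j)\<in>pairs n. of_bool ((i, j) \<in> blocks J S))"
        by (rule sum.cong[OF refl]) (use ind in auto)
      moreover have "S \<subseteq> J" using S by (simp add: left_end_sets_def)
      moreover have "ind S \<in> pos_roots n \<rightarrow>\<^sub>E UNIV" by (simp add: ind_def)
      ultimately show "ind S \<in> ?K"
        unfolding iff using sum_blocks_cover[OF J S] sum_blocks_total[OF J, of S] d by simp
    qed
    show "starts ` ?K \<subseteq> {S \<in> left_end_sets J. card S = d}"
    proof (rule image_subsetI)
      fix m assume m: "m \<in> ?K"
      have "d = (\<Sum>(i, j)\<in>pairs n. of_bool ((i, j) \<in> blocks J (starts m)))"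
        unfolding total[OF m, symmetric] by (rule sum.cong[OF refl]) (use blocks[OF m] in auto)
      also have "\<dots> = card (starts m)"
        using sum_blocks_total[OF J] starts[OF m] by (simp add: left_end_sets_def)
      finally show "starts m \<in> {S \<in> left_end_sets J. card S = d}" using starts[OF m] by simp
    qed
  qed
  then show ?thesis by (rule bij_betw_same_card[symmetric])
qed

lemma kostant_q_simple_sum:
  assumes J: "J \<subseteq> {..<n - 1}"
  shows "kostant_q n (\<Sum>k\<in>J. pos_root n k (Suc k)) = (\<Sum>S\<in>left_end_sets J. monom 1 (card S))"
proof (rule poly_eqI)
  fix d
  have "finite J" using finite_subset[OF J] by simp
  then have fin: "finite (left_end_sets J)"
    by (rule finite_subset[rotated, OF finite_Pow_iff[THEN iffD2]]) (auto simp: left_end_sets_def)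
  then have "coeff (\<Sum>S\<in>left_end_sets J. monom 1 (card S)) d = int (card {S \<in> left_end_sets J. card S = d})"
    by (simp add: coeff_sum sum.If_cases Int_def)
  then show "coeff (kostant_q n (\<Sum>k\<in>J. pos_root n k (Suc k))) d =
      coeff (\<Sum>S\<in>left_end_sets J. monom 1 (card S)) d"
    by (simp only: coeff_kostant_q card_kostant_partitions_simple_sum[OF J])
qed

section \<open>Products of commuting simple reflections\<close>

text \<open>
  The product of the commuting transpositions of \<open>i\<close> and \<open>Suc i\<close> for \<open>i\<close> in \<open>I\<close>, provided
  that \<open>I\<close> has no two consecutive elements.
\<close>
definition adj_swaps :: "nat set \<Rightarrow> nat \<Rightarrow> nat" where
  "adj_swaps I x = (if x \<in> I then Suc x else if x \<in> Suc ` I then x - 1 else x)"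

definition nonadjacent :: "nat set \<Rightarrow> bool" where
  "nonadjacent I \<longleftrightarrow> (\<forall>i\<in>I. Suc i \<notin> I)"

lemma adj_swaps_involution: "nonadjacent I \<Longrightarrow> adj_swaps I (adj_swaps I x) = x"
  by (cases x) (auto simp: adj_swaps_def nonadjacent_def)

lemma inv_adj_swaps: "nonadjacent I \<Longrightarrow> inv_into UNIV (adj_swaps I) = adj_swaps I"
  by (rule inv_unique_comp) (auto simp: fun_eq_iff adj_swaps_involution)

lemma adj_swaps_insert:
  assumes "i \<notin> I" "nonadjacent (insert i I)"
  shows "adj_swaps (insert i I) = transpose i (Suc i) \<circ> adj_swaps I"
proof
  fix x
  have "Suc i \<notin> I" "i = 0 \<or> i - 1 \<notin> I"
    using assms by (auto simp: nonadjacent_def)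
  then show "adj_swaps (insert i I) x = (transpose i (Suc i) \<circ> adj_swaps I) x"
    using assms(1) by (cases x; cases i) (auto simp: adj_swaps_def transpose_def, metis gr0I)
qed

lemma inj_adj_swaps: "inj adj_swaps"
proof (rule injI)
  fix I K assume "adj_swaps I = adj_swaps K"
  moreover have "I = {x. x < adj_swaps I x}" for I
    by (auto simp: adj_swaps_def)
  ultimately show "I = K" by metis
qed

definition word_prod :: "('a \<Rightarrow> 'a) list \<Rightarrow> 'a \<Rightarrow> 'a" where
  "word_prod ws = foldr (\<circ>) ws id"

lemma word_prod_simps: "word_prod [] = id" "word_prod (w # ws) = w \<circ> word_prod ws"
  by (simp_all add: word_prod_def)

text \<open>
  Multiplying the transpositions in any order gives a word of length \<open>card I\<close>, whose parity
  determines the sign by \<open>weyl_sign_word\<close>.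
\<close>
lemma adj_swaps_word:
  assumes "finite I" "I \<subseteq> {..<n - 1}" "nonadjacent I"
  shows "\<exists>ws. length ws = card I \<and> set ws \<subseteq> simple_reflections n \<and> word_prod ws = adj_swaps I"
  using assms
proof (induction I)
  case empty
  then show ?case by (auto simp: adj_swaps_def fun_eq_iff word_prod_simps)
next
  case (insert i I)
  then have "I \<subseteq> {..<n - 1}" "nonadjacent I" by (auto simp: nonadjacent_def)
  from insert.IH[OF this] obtain ws where ws: "length ws = card I" "set ws \<subseteq> simple_reflections n"
      "word_prod ws = adj_swaps I" by blast
  have "transpose i (Suc i) \<in> simple_reflections n"
    using insert.prems(1) by (auto simp: simple_reflections_def)
  with ws insert show ?case
    by (intro exI[of _ "transpose i (Suc i) # ws"]) (simp add: adj_swaps_insert word_prod_simps)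
qed

lemma permutes_word:
  "set ws \<subseteq> simple_reflections n \<Longrightarrow> word_prod ws permutes {..<n}"
proof (induction ws)
  case (Cons w ws)
  then have "w permutes {..<n}"
    by (auto simp: simple_reflections_def intro: permutes_swap_id)
  moreover have "word_prod ws permutes {..<n}" using Cons by simp
  ultimately show ?case using permutes_compose by (simp only: word_prod_simps)
qed (simp add: word_prod_simps permutes_id)

lemma sign_word:
  "set ws \<subseteq> simple_reflections n \<Longrightarrow> sign (word_prod ws) = (- 1) ^ length ws"
proof (induction ws)
  case (Cons w ws)
  then obtain i where w: "w = transpose i (Suc i)"
    by (auto simp: simple_reflections_def)
  have "permutation (word_prod ws)"
    using permutes_word[of ws n] Cons.prems permutation_permutes by auto
  moreover have "sign (word_prod ws) = (- 1) ^ length ws" using Cons by simp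
  ultimately have "sign (w \<circ> word_prod ws) = - ((- 1) ^ length ws)"
    unfolding w by (subst sign_compose) (simp_all add: permutation_swap_id sign_swap_id)
  then show ?case by (simp only: word_prod_simps length_Cons power_Suc mult_minus1)
qed (simp add: word_prod_simps)

text \<open>
  The sign of a permutation is determined by the parity of any word for it, in particular by that of
  a shortest one.
\<close>
lemma weyl_sign_word:
  assumes "set ws \<subseteq> simple_reflections n"
  shows "weyl_sign n (word_prod ws) = (- 1) ^ length ws"
proof -
  let ?P = "\<lambda>k. \<exists>vs. length vs = k \<and> set vs \<subseteq> simple_reflections n \<and> word_prod vs = word_prod ws"
  have "?P (weyl_length n (word_prod ws))"
    unfolding weyl_length_def word_prod_def[symmetric] by (rule LeastI[of ?P "length ws"]) (use assms in blast)
  then show ?thesis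
    unfolding weyl_sign_def using sign_word assms by metis
qed

lemma
  assumes "I \<subseteq> {..<n - 1}" "nonadjacent I"
  shows weyl_sign_adj_swaps: "weyl_sign n (adj_swaps I) = (- 1) ^ card I"
    and adj_swaps_permutes: "adj_swaps I permutes {..<n}"
proof -
  have "finite I" using finite_subset[OF assms(1)] by simp
  from adj_swaps_word[OF this assms] obtain ws where
    "length ws = card I" "set ws \<subseteq> simple_reflections n" "word_prod ws = adj_swaps I" by blast
  then show "weyl_sign n (adj_swaps I) = (- 1) ^ card I" "adj_swaps I permutes {..<n}"
    using weyl_sign_word[of ws n] permutes_word[of ws n] by auto
qed

text \<open>
  Applied to the image of an initial segment under an injection of the naturals, this says that the
  values there sum to at least the sum of the arguments.
\<close>
lemma sum_lessThan_card_le: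
  fixes A :: "nat set"
  assumes "finite A"
  shows "\<Sum>{..<card A} \<le> \<Sum>A"
  using assms
proof (induction rule: finite_linorder_max_induct)
  case (insert b A)
  then have "card A \<le> b" using card_mono[of "{..<b}" A] by auto
  moreover have "b \<notin> A" using insert by auto
  ultimately show ?case using insert by simp
qed simp

text \<open>
  The sums over initial segments of \<open>\<tau> i - i\<close> are never negative because \<open>\<tau>\<close> is injective, so
  under the hypothesis they are all 0 or 1, and \<open>\<tau>\<close> can be recovered from them as successive
  differences. Two consecutive sums equal to 1, the first of them preceded by 0, would give \<open>\<tau>\<close>
  the same value twice; hence \<open>I\<close> has no consecutive elements.
\<close>
lemma small_displacement_imp_adj_swaps:
  assumes \<tau>: "\<tau> permutes {..<n}"
    and le1: "\<And>k. k < n \<Longrightarrow> (\<Sum>i\<le>k. int (\<tau> i) - int i) \<le> 1"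
  defines "I \<equiv> {k. k < n \<and> (\<Sum>i\<le>k. int (\<tau> i) - int i) = 1}"
  shows "nonadjacent I" and "\<tau> = adj_swaps I"
proof -
  define d where "d k = (\<Sum>i\<le>k. int (\<tau> i) - int i)" for k
  have inj: "\<tau> x = \<tau> y \<Longrightarrow> x = y" for x y
    using permutes_inj[OF \<tau>] by (auto dest: injD)
  have "0 \<le> d k" for k
  proof -
    have "inj_on \<tau> {..k}" using inj by (auto intro: inj_onI)
    then have "\<Sum>{..<Suc k} \<le> (\<Sum>i\<le>k. \<tau> i)"
      using sum_lessThan_card_le[of "\<tau> ` {..k}"] by (simp add: card_image sum.reindex)
    then have "int (\<Sum>i\<le>k. i) \<le> int (\<Sum>i\<le>k. \<tau> i)"
      unfolding lessThan_Suc_atMost by (simp only: of_nat_le_iff)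
    then show ?thesis by (simp add: d_def sum_subtractf)
  qed
  then have d01: "d k = (if k \<in> I then 1 else 0)" if "k < n" for k
    using le1[OF that] that d_def[of k] by (auto simp: I_def antisym_conv)
      (metis int_one_le_iff_zero_less order_le_less order_antisym)
  have \<tau>0: "int (\<tau> 0) = d 0" by (simp add: d_def)
  have \<tau>Suc: "int (\<tau> (Suc k)) = int (Suc k) + d (Suc k) - d k" for k
    by (simp add: d_def)
  have "k \<in> I \<longrightarrow> Suc k \<notin> I" for k
  proof (induction k)
    case 0
    show ?case
    proof (intro impI notI)
      assume "0 \<in> I" "Suc 0 \<in> I"
      then have "0 < n" "Suc 0 < n" by (auto simp: I_def)
      then have "\<tau> 0 = \<tau> (Suc 0)"
        using \<tau>0 \<tau>Suc[of 0] d01[of 0] d01[of "Suc 0"] \<open>0 \<in> I\<close> \<open>Suc 0 \<in> I\<close> by simp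
      then show False using inj[of 0 "Suc 0"] by simp
    qed
  next
    case (Suc k)
    show ?case
    proof (intro impI notI)
      assume *: "Suc k \<in> I" "Suc (Suc k) \<in> I"
      then have "k \<notin> I" "Suc (Suc k) < n" using Suc by (auto simp: I_def)
      then have "\<tau> (Suc k) = \<tau> (Suc (Suc k))"
        using \<tau>Suc[of k] \<tau>Suc[of "Suc k"] d01[of k] d01[of "Suc k"] d01[of "Suc (Suc k)"] * by simp
      then show False using inj[of "Suc k" "Suc (Suc k)"] by simp
    qed
  qed
  then show na: "nonadjacent I" by (auto simp: nonadjacent_def)
  show "\<tau> = adj_swaps I"
  proof
    fix x
    show "\<tau> x = adj_swaps I x"
    proof (cases "x < n")
      case True
      show ?thesis
      proof (cases x)
        case 0
        then show ?thesis using \<tau>0 d01[of 0] True by (auto simp: adj_swaps_def)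
      next
        case (Suc y)
        have "\<not> (y \<in> I \<and> Suc y \<in> I)" using na by (auto simp: nonadjacent_def)
        then show ?thesis
          using \<tau>Suc[of y] d01[of y] d01[of "Suc y"] True Suc
          by (auto simp: adj_swaps_def split: if_splits)
      qed
    next
      case False
      have "n - 1 \<notin> I"
      proof
        assume a: "n - 1 \<in> I"
        have n: "{..n - 1} = {..<n}" using a by (auto simp: I_def)
        have "(\<Sum>i<n. int (\<tau> i)) = (\<Sum>i<n. int i)"
          using sum.permute[OF \<tau>, of int] by (simp add: o_def)
        then have "d (n - 1) = 0" unfolding d_def n sum_subtractf by simp
        with d01[of "n - 1"] a show False by (auto simp: I_def)
      qed
      then have "x \<notin> I" "x \<notin> Suc ` I"
        using False by (auto simp: I_def not_less less_Suc_eq_le dest: le_antisym)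
      then show ?thesis using False permutes_not_in[OF \<tau>, of x] by (auto simp: adj_swaps_def)
    qed
  qed
qed

section \<open>The contributing Weyl group elements\<close>

text \<open>
  With the simple roots numbered \<open>0, \<dots>, n - 2\<close>, these are the sets of pairwise orthogonal simple
  roots that are also orthogonal to the highest root.
\<close>
definition contributing_sets :: "nat \<Rightarrow> nat set set" where
  "contributing_sets n = {I. I \<subseteq> {1..<n - 2} \<and> nonadjacent I}"

text \<open>
  The product of reflections fixes the highest root and subtracts from \<open>rho n\<close> the simple roots in
  \<open>I\<close>, and the highest root is the sum of all simple roots. The proof compares the coefficients of
  the \<open>eps n i\<close>.
\<close>
lemma kostant_weight_adj_swaps:
  assumes n: "n \<ge> 2" and I: "I \<in> contributing_sets n"
  shows "kostant_weight n (adj_swaps I) = (\<Sum>k\<in>{..<n - 1} - I. pos_root n k (Suc k))"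
proof
  fix H
  let ?J = "{..<n - 1} - I"
  have na: "nonadjacent I" and sub: "I \<subseteq> {1..<n - 2}"
    using I by (auto simp: contributing_sets_def)
  have perm: "adj_swaps I permutes {..<n}"
    using adj_swaps_permutes[of I n] na sub by force
  show "kostant_weight n (adj_swaps I) H = (\<Sum>k\<in>?J. pos_root n k (Suc k)) H"
  proof (cases "H \<in> cartan n")
    case False
    then show ?thesis
      by (simp add: kostant_weight_def weyl_act_def rho_def scale_weight_def sum_weight_apply
          sum_pos_roots case_prod_unfold pos_root_def eps_def)
  next
    case True
    define h where "h i = H $$ (i, i)" for i
    have coeff: "int i - neg_exponent n (adj_swaps I i) = of_bool (i \<in> ?J) - of_bool (i \<in> Suc ` ?J)"
      if "i < n" for i
    proof -
      have lo: "1 \<le> i \<and> i < n - 2" if p: "i \<in> I"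
        using sub p by (metis atLeastLessThan_iff subsetD)
      have hi: "2 \<le> i \<and> i < n - 1" if q: "i \<in> Suc ` I"
      proof -
        obtain l where "l \<in> I" "i = Suc l" using q by blast
        then have "1 \<le> l \<and> l < n - 2" using sub by (metis atLeastLessThan_iff subsetD)
        then show ?thesis using \<open>i = Suc l\<close> by linarith
      qed
      have J: "i \<in> ?J \<longleftrightarrow> i < n - 1 \<and> i \<notin> I" by simp
      have SJ: "i \<in> Suc ` ?J \<longleftrightarrow> i \<noteq> 0 \<and> i \<notin> Suc ` I"
        using that by (cases i) auto
      consider "i \<in> I" "i \<notin> Suc ` I" | "i \<notin> I" "i \<in> Suc ` I" | "i \<notin> I" "i \<notin> Suc ` I"
        using na by (auto simp: nonadjacent_def)
      then show ?thesis
      proof cases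
        case 1
        moreover have "Suc (Suc i) \<noteq> n" using lo 1 by linarith
        ultimately show ?thesis unfolding J SJ using lo by (simp add: neg_exponent_def adj_swaps_def)
      next
        case 2
        moreover have "i \<noteq> n" using hi 2 by linarith
        ultimately show ?thesis unfolding J SJ using hi
          by (simp add: neg_exponent_def adj_swaps_def of_nat_diff)
      next
        case 3
        then show ?thesis unfolding J SJ using that n
          by (simp add: neg_exponent_def adj_swaps_def of_bool_def) linarith
      qed
    qed
    have "kostant_weight n (adj_swaps I) H = (\<Sum>i<n. (of_bool (i \<in> ?J) - of_bool (i \<in> Suc ` ?J)) * h i)"
      unfolding kostant_weight_apply[OF order_trans[OF one_le_numeral n] perm True] inv_adj_swaps[OF na]
      by (intro sum.cong refl) (simp add: coeff h_def del: of_int_diff)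
    also have "\<dots> = (\<Sum>i<n. of_bool (i \<in> ?J) * h i) - (\<Sum>i<n. of_bool (i \<in> Suc ` ?J) * h i)"
      by (simp only: left_diff_distrib sum_subtractf)
    also have "(\<Sum>i<n. of_bool (i \<in> ?J) * h i) = (\<Sum>k\<in>?J. h k)"
      by (intro sum.mono_neutral_cong_right) auto
    also have "(\<Sum>i<n. of_bool (i \<in> Suc ` ?J) * h i) = (\<Sum>k\<in>Suc ` ?J. h k)"
      by (intro sum.mono_neutral_cong_right) auto
    also have "\<dots> = (\<Sum>k\<in>?J. h (Suc k))"
      by (subst sum.reindex) auto
    finally show ?thesis
      using True by (simp add: sum_weight_apply pos_root_def eps_def h_def sum_subtractf)
  qed
qed

text \<open>
  Non-negativity of the first and last coordinate forces \<open>\<sigma>\<close> to fix \<open>0\<close> and \<open>n - 1\<close>. After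
  that, the coordinate of index \<open>k\<close> is one minus the displacement of \<open>{..k}\<close>, so that
  \<open>small_displacement_imp_adj_swaps\<close> applies.
\<close>
lemma kostant_partition_imp_adj_swaps:
  assumes n: "n \<ge> 2" and \<sigma>: "\<sigma> permutes {..<n}"
    and m: "m \<in> kostant_partitions n (kostant_weight n \<sigma>) d"
  shows "\<exists>I\<in>contributing_sets n. \<sigma> = adj_swaps I"
proof -
  \<comment> \<open>The coefficient of \<open>eps n i\<close> in \<open>kostant_weight n \<sigma>\<close> involves the preimage of \<open>i\<close>.\<close>
  define \<tau> where "\<tau> = inv_into UNIV \<sigma>"
  have \<tau>: "\<tau> permutes {..<n}" unfolding \<tau>_def by (rule permutes_inv[OF \<sigma>])
  have lt: "\<tau> i < n" if "i < n" for i using permutes_in_image[OF \<tau>, of i] that by simp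
  have inj: "\<tau> x = \<tau> y \<Longrightarrow> x = y" for x y
    using permutes_inj[OF \<tau>] by (auto dest: injD)
  have nonneg: "0 \<le> (\<Sum>i\<le>k. int i - neg_exponent n (\<tau> i))" if k: "k < n" for k
  proof -
    let ?N = "\<Sum>(i, j)\<in>{(i, j) \<in> pairs n. i \<le> k \<and> k < j}. m (pos_root n i j)"
    have "(of_int (\<Sum>i\<le>k. int i - neg_exponent n (\<tau> i)) :: complex) = of_nat ?N"
      unfolding \<tau>_def
      by (rule trans[OF kostant_weight_coweight[OF k \<sigma>, symmetric] kostant_partition_coweight[OF m k]])
    also have "\<dots> = of_int (int ?N)"
      by (rule of_int_of_nat_eq[symmetric])
    finally have "(\<Sum>i\<le>k. int i - neg_exponent n (\<tau> i)) = int ?N"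
      by (simp only: of_int_eq_iff)
    then show ?thesis by (simp only: of_nat_0_le_iff)
  qed
  have \<tau>0: "\<tau> 0 = 0"
  proof (rule ccontr)
    assume "\<tau> 0 \<noteq> 0"
    then have "1 \<le> neg_exponent n (\<tau> 0)" by (simp add: neg_exponent_def)
    with nonneg[of 0] n show False by simp
  qed
  have \<tau>n: "\<tau> (n - 1) = n - 1"
  proof (rule ccontr)
    assume ne: "\<tau> (n - 1) \<noteq> n - 1"
    have "{..<n} = insert (n - 1) {..n - 2}" using n by auto
    then have "(\<Sum>i<n. int i - neg_exponent n (\<tau> i)) =
        (\<Sum>i\<le>n - 2. int i - neg_exponent n (\<tau> i)) + (int (n - 1) - neg_exponent n (\<tau> (n - 1)))"
      using n by simp
    moreover have "(\<Sum>i<n. int i - neg_exponent n (\<tau> i)) = 0"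
      using sum.permute[OF \<tau>, of "neg_exponent n"] sum_neg_exponent[of n] n
      by (simp add: o_def sum_subtractf)
    ultimately have "int (n - 1) \<le> neg_exponent n (\<tau> (n - 1))"
      using nonneg[of "n - 2"] n by simp
    moreover have "Suc (\<tau> (n - 1)) \<noteq> n" "\<tau> (n - 1) < n" using ne lt[of "n - 1"] n by auto
    ultimately show False
      using n by (cases "\<tau> (n - 1) = 0") (simp_all add: neg_exponent_def)
  qed
  have below: "(\<Sum>i\<le>k. int (\<tau> i) - int i) \<le> 1" if k: "k < n - 1" for k
  proof -
    have "neg_exponent n (\<tau> i) = int (\<tau> i) - (if i = 0 then 1 else 0)" if "i \<le> k" for i
    proof -
      have "\<tau> i = 0 \<longleftrightarrow> i = 0" using inj[of i 0] \<tau>0 by auto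
      moreover have "Suc (\<tau> i) \<noteq> n"
        using inj[of i "n - 1"] \<tau>n k that n by auto
      ultimately show ?thesis by (simp add: neg_exponent_def)
    qed
    then have "(\<Sum>i\<le>k. int i - neg_exponent n (\<tau> i)) =
        (\<Sum>i\<le>k. int i - int (\<tau> i) + (if i = 0 then 1 else 0))"
      by (intro sum.cong) auto
    also have "\<dots> = 1 - (\<Sum>i\<le>k. int (\<tau> i) - int i)"
      by (simp add: sum.distrib sum_subtractf)
    finally show ?thesis using nonneg[of k] k by simp
  qed
  have last: "(\<Sum>i\<le>n - 1. int (\<tau> i) - int i) = 0"
  proof -
    have "{..n - 1} = {..<n}" using n by auto
    then show ?thesis
      using sum.permute[OF \<tau>, of int] by (simp add: o_def sum_subtractf)
  qed
  define I where "I = {k. k < n \<and> (\<Sum>i\<le>k. int (\<tau> i) - int i) = 1}"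
  have le1: "(\<Sum>i\<le>k. int (\<tau> i) - int i) \<le> 1" if "k < n" for k
    using below[of k] last that by (cases "k = n - 1") auto
  have na: "nonadjacent I" and eq: "\<tau> = adj_swaps I"
    using small_displacement_imp_adj_swaps[OF \<tau> le1] unfolding I_def by auto
  have "0 \<notin> I" using \<tau>0 by (simp add: I_def)
  moreover have "n - 1 \<notin> I" using last by (simp add: I_def)
  moreover have "n - 2 \<notin> I"
  proof
    assume "n - 2 \<in> I"
    moreover have "{..n - 1} = insert (n - 1) {..n - 2}" using n by auto
    ultimately show False using last \<tau>n n by (simp add: I_def)
  qed
  ultimately have "I \<subseteq> {1..<n - 2}"
  proof -
    have "k \<in> {1..<n - 2}" if "k \<in> I" for k
    proof -
      have "k \<noteq> 0" "k \<noteq> n - 1" "k \<noteq> n - 2"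
        using that \<open>0 \<notin> I\<close> \<open>n - 1 \<notin> I\<close> \<open>n - 2 \<notin> I\<close> by metis+
      moreover have "k < n" using that by (simp add: I_def)
      ultimately show ?thesis by auto
    qed
    then show ?thesis by blast
  qed
  moreover have "\<sigma> = adj_swaps I"
    using permutes_inv_inv[OF \<sigma>] inv_adj_swaps[OF na] eq unfolding \<tau>_def by metis
  ultimately show ?thesis using na by (auto simp: contributing_sets_def)
qed

section \<open>Cancellation\<close>

text \<open>
  The runs of the complement of \<open>I\<close> start at \<open>0\<close> and just after the elements of \<open>I\<close>.
\<close>
lemma left_end_sets_complement:
  assumes "I \<in> contributing_sets (r + 1)" "r \<ge> 1"
  shows "left_end_sets ({..<r} - I) = {S \<in> {S. S \<subseteq> {..<r} \<and> 0 \<in> S}. I \<inter> S = {} \<and> Suc ` I \<subseteq> S}"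
proof -
  let ?J = "{..<r} - I"
  have na: "nonadjacent I" and sub: "I \<subseteq> {1..<r - 1}"
    using assms(1) by (auto simp: contributing_sets_def)
  have *: "{k \<in> ?J. k = 0 \<or> k - 1 \<notin> ?J} = insert 0 (Suc ` I)" (is "?L = ?R")
  proof
    show "?L \<subseteq> ?R"
    proof
      fix k assume "k \<in> ?L"
      then show "k \<in> ?R" by (cases k) auto
    qed
    have "0 \<in> ?J" using sub assms(2) by auto
    moreover have "Suc i \<in> ?J" "i \<notin> ?J" if "i \<in> I" for i
    proof -
      have "i < r - 1" using that sub by (metis atLeastLessThan_iff subsetD)
      then show "Suc i \<in> ?J" "i \<notin> ?J" using that na by (auto simp: nonadjacent_def)
    qed
    ultimately show "?R \<subseteq> ?L" by auto
  qed
  have "left_end_sets ?J = {S. S \<subseteq> ?J \<and> {k \<in> ?J. k = 0 \<or> k - 1 \<notin> ?J} \<subseteq> S}"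
    unfolding left_end_sets_def by blast
  then show ?thesis unfolding * by auto
qed

lemma sum_minus_one_power_card_Pow:
  assumes "finite D"
  shows "(\<Sum>I\<in>Pow D. (- 1) ^ card I) = (of_bool (D = {}) :: int)"
proof -
  have "(\<Sum>I\<in>Pow D. (- 1) ^ card I) = (\<Prod>x\<in>D. 1 - 1 :: int)"
    by (subst prod_diff_conv_sum[OF assms]) simp
  then show ?thesis using assms by auto
qed

lemma smult_sum_right: "smult c (\<Sum>x\<in>A. f x) = (\<Sum>x\<in>A. smult c (f x))"
  by (induction A rule: infinite_finite_induct) (auto simp: smult_add_right)

text \<open>
  A nonempty finite set of naturals closed under predecessors is an initial segment.
\<close>
lemma initial_intervals:
  "{S. S \<subseteq> {..<r} \<and> 0 \<in> S \<and> {i. i \<notin> S \<and> Suc i \<in> S} = {}} = lessThan ` {1..r}" (is "?L = ?R")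
proof
  show "?L \<subseteq> ?R"
  proof
    fix S assume S: "S \<in> ?L"
    then have fin: "finite S" "S \<noteq> {}" using finite_subset[of S "{..<r}"] by auto
    have "i \<in> S" if "i \<le> Max S" for i
      using that by (induction rule: inc_induct) (use Max_in[OF fin] S in auto)
    then have "i \<in> S \<longleftrightarrow> i < Suc (Max S)" for i
      using Max_ge[OF fin(1), of i] by (metis less_Suc_eq_le)
    then have "S = {..<Suc (Max S)}" by blast
    moreover have "Max S < r" using Max_in[OF fin] S by blast
    ultimately show "S \<in> ?R" by (intro image_eqI[of _ _ "Suc (Max S)"]) auto
  qed
qed auto

theorem theorem3p1:
  fixes r :: nat
  assumes "r \<ge> 1"
  shows "mult_q (r + 1) (highest_root (r + 1)) 0 = (\<Sum>k=1..r. monom 1 k)"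
proof -
  let ?n = "r + 1"
  let ?A = "contributing_sets ?n"
  let ?B = "{S. S \<subseteq> {..<r} \<and> 0 \<in> S}"
  let ?R = "\<lambda>I S. I \<inter> S = {} \<and> Suc ` I \<subseteq> S"
  let ?D = "\<lambda>S. {i. i \<notin> S \<and> Suc i \<in> S}"
  let ?t = "\<lambda>\<sigma>. smult (weyl_sign ?n \<sigma>) (kostant_q ?n (kostant_weight ?n \<sigma>))"
  have n: "?n \<ge> 2" using assms by simp
  have finA: "finite ?A"
    by (rule finite_subset[of _ "Pow {1..<?n - 2}"]) (auto simp: contributing_sets_def)
  have finB: "finite ?B"
    by (rule finite_subset[of _ "Pow {..<r}"]) auto
  have finD: "finite (?D S)" if "S \<in> ?B" for S
    by (rule finite_subset[of _ "{..<r}"]) (use that in auto)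
  have Asub: "I \<subseteq> {..<?n - 1}" "nonadjacent I" if "I \<in> ?A" for I
  proof -
    have "I \<subseteq> {1..<?n - 2}" using that by (simp add: contributing_sets_def)
    also have "\<dots> \<subseteq> {..<?n - 1}" by auto
    finally show "I \<subseteq> {..<?n - 1}" .
    show "nonadjacent I" using that by (simp add: contributing_sets_def)
  qed
  have "mult_q ?n (highest_root ?n) 0 = (\<Sum>\<sigma>\<in>weyl_group ?n. ?t \<sigma>)"
    by (simp add: mult_q_def kostant_weight_def)
  also have "\<dots> = (\<Sum>\<sigma>\<in>adj_swaps ` ?A. ?t \<sigma>)"
  proof (rule sum.mono_neutral_right)
    show "finite (weyl_group ?n)" by (simp add: weyl_group_def finite_permutations)
    show "adj_swaps ` ?A \<subseteq> weyl_group ?n"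
      using adj_swaps_permutes[OF Asub] by (auto simp: weyl_group_def)
    show "\<forall>\<sigma>\<in>weyl_group ?n - adj_swaps ` ?A. ?t \<sigma> = 0"
    proof
      fix \<sigma> assume "\<sigma> \<in> weyl_group ?n - adj_swaps ` ?A"
      then have "kostant_partitions ?n (kostant_weight ?n \<sigma>) d = {}" for d
        using kostant_partition_imp_adj_swaps[OF n, of \<sigma> _ d] by (auto simp: weyl_group_def)
      then show "?t \<sigma> = 0" by (simp add: poly_eq_iff coeff_kostant_q)
    qed
  qed
  also have "\<dots> = (\<Sum>I\<in>?A. ?t (adj_swaps I))"
    by (subst sum.reindex) (auto intro: inj_on_subset[OF inj_adj_swaps])
  also have "\<dots> = (\<Sum>I\<in>?A. \<Sum>S\<in>{S \<in> ?B. ?R I S}. smult ((- 1) ^ card I) (monom 1 (card S)))"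
  proof (rule sum.cong[OF refl])
    fix I assume I: "I \<in> ?A"
    have "kostant_q ?n (kostant_weight ?n (adj_swaps I)) =
        (\<Sum>S\<in>left_end_sets ({..<r} - I). monom 1 (card S))"
      using kostant_q_simple_sum[of "{..<r} - I" ?n] kostant_weight_adj_swaps[OF n I] by simp
    then show "?t (adj_swaps I) = (\<Sum>S\<in>{S \<in> ?B. ?R I S}. smult ((- 1) ^ card I) (monom 1 (card S)))"
      by (simp only: weyl_sign_adj_swaps[OF Asub[OF I]] left_end_sets_complement[OF I assms] smult_sum_right)
  qed
  also have "\<dots> = (\<Sum>S\<in>?B. \<Sum>I\<in>{I \<in> ?A. ?R I S}. smult ((- 1) ^ card I) (monom 1 (card S)))"
    by (rule sum.swap_restrict[OF finA finB])
  also have "\<dots> = (\<Sum>S\<in>?B. if ?D S = {} then monom 1 (card S) else 0)"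
  proof (rule sum.cong[OF refl])
    fix S assume S: "S \<in> ?B"
    \<comment> \<open>Disjointness from \<open>S\<close> and \<open>Suc ` I \<subseteq> S\<close> already imply that \<open>I\<close> is a contributing set.\<close>
    have P: "{I \<in> ?A. ?R I S} = Pow (?D S)"
    proof
      have "I \<in> ?A" if "I \<subseteq> ?D S" for I
      proof -
        have "i \<in> {1..<?n - 2} \<and> Suc i \<notin> I" if "i \<in> I" for i
        proof -
          have "i \<notin> S" "Suc i \<in> S" "Suc i \<notin> I" using that \<open>I \<subseteq> ?D S\<close> by auto
          moreover have "i \<noteq> 0" using S \<open>i \<notin> S\<close> by (auto intro: gr0I)
          moreover have "Suc i < r" using S \<open>Suc i \<in> S\<close> by auto
          ultimately show ?thesis by auto
        qed
        then show ?thesis by (auto simp: contributing_sets_def nonadjacent_def)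
      qed
      then show "Pow (?D S) \<subseteq> {I \<in> ?A. ?R I S}" by auto
    qed auto
    have "(\<Sum>I\<in>{I \<in> ?A. ?R I S}. smult ((- 1) ^ card I) (monom 1 (card S))) =
        smult (\<Sum>I\<in>Pow (?D S). (- 1) ^ card I) (monom 1 (card S) :: int poly)"
      by (simp only: P smult_sum)
    also have "\<dots> = (if ?D S = {} then monom 1 (card S) else 0)"
      unfolding sum_minus_one_power_card_Pow[OF finD[OF S]] by simp
    finally show "(\<Sum>I\<in>{I \<in> ?A. ?R I S}. smult ((- 1) ^ card I) (monom 1 (card S))) =
        (if ?D S = {} then monom 1 (card S) else 0 :: int poly)" .
  qed
  also have "\<dots> = (\<Sum>S\<in>{S. S \<subseteq> {..<r} \<and> 0 \<in> S \<and> ?D S = {}}. monom 1 (card S))"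
    using finB by (intro sum.mono_neutral_cong_right) auto
  also have "\<dots> = (\<Sum>k=1..r. monom 1 k)"
    unfolding initial_intervals by (subst sum.reindex) (auto simp: inj_on_def)
  finally show ?thesis .
qed

end
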